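(* Let $q$ be a prime power and let $f$ be the growth function $f=\log_q^2$, i.e. $f(q^k)=k^2$ for $k\ge1$, with $f(1)=1$. Let $$M_q(t,\log^2)=\Big\{\Theta(t)\in\mathbb{I}:\ \inf_{N(t)\in\mathbb{F}_q[t]\setminus\{0\}}f(|N(t)|)\cdot|N(t)|\cdot|\langle\Theta(t)\cdot N(t)\rangle|\cdot|N(t)|_{t}>0\Big\}$$ be the set of counterexamples to the $t$-adic Littlewood Conjecture with growth function $\log^2$. Then $M_q(t,\log^2)$ has full Hausdorff dimension: $$\dim M_q(t,\log^2)=1.$$
   Context: $\mathbb{F}_q$ is the finite field with $q$ elements and $\mathbb{F}_q((t^{-1}))$ is the field of formal Laurent series $\Theta(t)=\sum_{i\ge -h}a_it^{-i}$ over $\mathbb{F}_q$. If $a_{-h}\ne0$ then $|\Theta(t)|=q^{h}$ (and $|0|=0$). The fractional part is $\langle\Theta(t)\rangle=\sum_{i\ge1}a_it^{-i}$. The unit interval is $\mathbb{I}=\{\Theta\in\mathbb{F}_q((t^{-1})):|\Theta|<1\}$. For nonzero $N(t)\in\mathbb{F}_q[t]$, $|N(t)|_t=q^{-i}$ with $i=\max\{j\ge0:t^j\mid N(t)\}$. $\dim$ is Hausdorff dimension with respect to the metric $(\Theta,\Phi)\mapsto|\Theta-\Phi|$ on $\mathbb{F}_q((t^{-1}))$. *)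

theory Defs
  imports
    "HOL-Analysis.Analysis"
    "HOL-Computational_Algebra.Computational_Algebra"
begin

text \<open>
  The field of formal Laurent series in the inverse of t over a finite field is the type of
  formal Laurent series whose formal variable \<^const>\<open>fls_X\<close> plays the role of the inverse of t.
  Hence t itself is \<^const>\<open>fls_X_inv\<close>, and the coefficient of the (-i)-th power of t in \<open>\<Theta>\<close>
  is \<open>fls_nth \<Theta> i\<close>. The number q of elements of the field is \<open>CARD('a)\<close>.
\<close>

definition fls_of_poly :: "'a::field poly \<Rightarrow> 'a fls" where
  "fls_of_poly N = poly (map_poly fls_const N) fls_X_inv"

definition laurent_abs :: "'a::{field,finite} fls \<Rightarrow> real" where
  "laurent_abs \<Theta> =
     (if \<Theta> = 0 then 0 else real CARD('a) powi (- fls_subdegree \<Theta>))"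

text \<open>
  The metric with base q; the metric that the library puts on \<^typ>\<open>'a fls\<close> has base 2 and would
  give different Hausdorff dimensions unless q = 2.
\<close>

definition laurent_dist :: "'a::{field,finite} fls \<Rightarrow> 'a fls \<Rightarrow> real" where
  "laurent_dist \<Theta> \<Phi> = laurent_abs (\<Theta> - \<Phi>)"

definition frac_part :: "'a::field fls \<Rightarrow> 'a fls" where
  "frac_part \<Theta> = fps_to_fls (Abs_fps (\<lambda>i. if i \<ge> 1 then fls_nth \<Theta> (int i) else 0))"

definition unit_interval :: "'a::{field,finite} fls set" where
  "unit_interval = {\<Theta>. laurent_abs \<Theta> < 1}"

text \<open>\<open>[:0, 1:]\<close> is the polynomial t. The maximum is meaningful only for nonzero N.\<close>

definition t_adic_abs :: "'a::{field,finite} poly \<Rightarrow> real" where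
  "t_adic_abs N = real CARD('a) powi (- int (Max {j. [:0, 1:] ^ j dvd N}))"

definition log_sq :: "real \<Rightarrow> real \<Rightarrow> real" where
  "log_sq q x = (if x = 1 then 1 else (log q x)\<^sup>2)"

definition tLC_counterexamples :: "(real \<Rightarrow> real) \<Rightarrow> 'a::{field,finite} fls set" where
  "tLC_counterexamples f =
     {\<Theta> \<in> unit_interval.
        (INF N \<in> UNIV - {0}.
           f (laurent_abs (fls_of_poly N)) * laurent_abs (fls_of_poly N)
             * laurent_abs (frac_part (\<Theta> * fls_of_poly N)) * t_adic_abs N) > 0}"

text \<open>
  The metric d is a parameter because the metric needed here is not the one of a type class
  instance. The diameter is that of a nonempty d-bounded set; only such sets occur below.
\<close>

definition diam :: "('a \<Rightarrow> 'a \<Rightarrow> real) \<Rightarrow> 'a set \<Rightarrow> real" where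
  "diam d U = (SUP (x, y) \<in> U \<times> U. d x y)"

text \<open>
  The s-th power of the diameter, with the convention that the empty set contributes 0 and, for
  s = 0, every nonempty set contributes 1 (whereas \<open>0 powr 0 = 0\<close>).
\<close>

definition diam_powr :: "('a \<Rightarrow> 'a \<Rightarrow> real) \<Rightarrow> real \<Rightarrow> 'a set \<Rightarrow> ennreal" where
  "diam_powr d s U =
     (if U = {} then 0 else if s = 0 then 1 else ennreal (diam d U powr s))"

definition delta_covers :: "('a \<Rightarrow> 'a \<Rightarrow> real) \<Rightarrow> real \<Rightarrow> 'a set \<Rightarrow> (nat \<Rightarrow> 'a set) set" where
  "delta_covers d \<delta> E =
     {U. E \<subseteq> (\<Union>i. U i) \<and> (\<forall>i. \<forall>x\<in>U i. \<forall>y\<in>U i. d x y \<le> \<delta>)}"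

definition hausdorff_measure :: "('a \<Rightarrow> 'a \<Rightarrow> real) \<Rightarrow> real \<Rightarrow> 'a set \<Rightarrow> ennreal" where
  "hausdorff_measure d s E =
     (SUP \<delta>\<in>{0<..}. INF U\<in>delta_covers d \<delta> E. \<Sum>i. diam_powr d s (U i))"

definition hausdorff_dim :: "('a \<Rightarrow> 'a \<Rightarrow> real) \<Rightarrow> 'a set \<Rightarrow> ennreal" where
  "hausdorff_dim d E = (INF s\<in>{s. s \<ge> 0 \<and> hausdorff_measure d s E = 0}. ennreal s)"

lemma fls_nth_of_poly:
  "fls_nth (fls_of_poly N) n = (if n \<le> 0 then coeff N (nat (- n)) else 0)"
proof (induction N arbitrary: n)
  case 0
  then show ?case by (simp add: fls_of_poly_def)
next
  case (pCons a N)
  have "fls_of_poly (pCons a N) = fls_const a + fls_X_inv * fls_of_poly N"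
    using pCons(1) by (simp add: fls_of_poly_def map_poly_pCons)
  then show ?case
    by (auto simp: pCons(2) fls_X_inv_times_conv_shift coeff_pCons nat_diff_distrib split: nat.split)
qed

lemma laurent_abs_fls_of_poly:
  fixes N :: "'a::{field,finite} poly"
  assumes "N \<noteq> 0"
  shows "laurent_abs (fls_of_poly N) = real CARD('a) ^ degree N"
proof -
  have "fls_nth (fls_of_poly N) (- int (degree N)) \<noteq> 0"
    using assms by (simp add: fls_nth_of_poly)
  moreover have "fls_nth (fls_of_poly N) k = 0" if "k < - int (degree N)" for k
    using that by (auto simp: fls_nth_of_poly intro!: coeff_eq_0)
  ultimately have "fls_subdegree (fls_of_poly N) = - int (degree N)"
    by (intro fls_subdegree_eqI) auto
  moreover have "fls_of_poly N \<noteq> 0"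
    using \<open>fls_nth (fls_of_poly N) (- int (degree N)) \<noteq> 0\<close> by auto
  ultimately show ?thesis by (simp add: laurent_abs_def)
qed

lemma fls_nth_frac_part: "fls_nth (frac_part \<Theta>) n = (if n \<ge> 1 then fls_nth \<Theta> n else 0)"
  by (auto simp: frac_part_def fps_to_fls_nth)

lemma t_adic_abs_altdef:
  fixes N :: "'a::{field,finite} poly"
  assumes "N \<noteq> 0"
  shows "t_adic_abs N = real CARD('a) powi (- int (order 0 N))"
proof -
  have "{j. [:0, 1:] ^ j dvd N} = {..order 0 N}"
    using assms order_divides[of 0 _ N] by auto
  moreover have "Max {..order 0 N} = order 0 N" by (intro Max_eqI) auto
  ultimately show ?thesis by (simp add: t_adic_abs_def)
qed

lemma log_sq_power:
  assumes "q > 1"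
  shows "log_sq q (q ^ k) = (if k = 0 then 1 else real k ^ 2)"
proof (cases "k = 0")
  case False
  then have "q ^ k \<noteq> 1" using one_less_power[OF assms, of k] by simp
  then show ?thesis using assms False by (simp add: log_sq_def log_nat_power)
qed (simp add: log_sq_def)

end

theory Submission
  imports Defs
begin

text \<open>
  Reading \<open>\<Theta>\<close> as the sequence of its digits, \<open>\<Theta>\<close> is a counterexample as soon as no prefix is
  obstructed, i.e. annihilated, as a linear recurrence, by a polynomial \<open>N\<close> of degree \<open>k\<close> and order
  \<open>j\<close> at 0 whose recurrence holds about \<open>k - j + 2 log k\<close> times. An obstructed word is determined by
  its first \<open>k\<close> letters and \<open>N\<close>, which allows for an inductive count: if \<open>W n\<close> is the number of words
  of length \<open>n\<close> without obstructed prefix, then \<open>(n + 1) W n / q ^ n\<close> is nondecreasing. The loss of a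
  factor \<open>1 - 1 / (n + 2)\<close> per letter is bounded by a constant between \<open>k\<close> and the length
  \<open>n \<le> 2 k + O(log k)\<close> of the word, and there are at most \<open>n\<close> choices of \<open>k\<close>, each forbidding a
  proportion of order \<open>1 / n ^ 2\<close>.

  The count tolerates forbidding in addition all words that extend an element of a set \<open>F\<close> with
  \<open>O(q ^ n / n ^ 2)\<close> elements of each length \<open>n\<close>, with a small constant.
  For \<open>s < 1\<close>, a cover with small sum of the s-th powers of the diameters yields cylinders that
  form such a set, and by Koenig's lemma there is a counterexample outside all of them. So the
  s-dimensional measure is positive.
\<close>

section \<open>Counting words without obstructed prefixes\<close>

lemma card_field_ge_2: "CARD('a::{field,finite}) \<ge> 2"
proof -
  have "card {0, 1::'a} \<le> CARD('a)" by (intro card_mono) auto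
  then show ?thesis by simp
qed

text \<open>
  Up to bounded factors \<open>q ^ window q k\<close> is \<open>(k + 1)\<^sup>2\<close>. The constant 16 makes the words that
  \<open>obstructs\<close> rules out rare enough for \<open>obstructed_words_negligible\<close>, where \<open>2 * 17 ^ 3 \<le> 2 ^ 15\<close>
  is needed.
\<close>

definition window :: "nat \<Rightarrow> nat \<Rightarrow> nat" where
  "window q k = (LEAST r. (k + 1)\<^sup>2 \<le> q ^ r) + 16"

lemma Suc_sq_le_power:
  assumes "q \<ge> (2::nat)"
  shows "(k + 1)\<^sup>2 \<le> q ^ (2 * k)"
proof -
  have "k + 1 \<le> 2 ^ k" using less_exp[of k] by (simp only: Suc_eq_plus1[symmetric] Suc_leI)
  also have "\<dots> \<le> q ^ k" using assms by (intro power_mono) auto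
  finally have "(k + 1)\<^sup>2 \<le> (q ^ k)\<^sup>2" by (intro power_mono) auto
  then show ?thesis by (simp only: power_even_eq)
qed

text \<open>Attainment of the \<open>LEAST\<close> exponent gives the lower bound on
  \<open>q ^ window q k\<close>, its minimality the upper one. The lower bound makes obstructed
  words rare, the upper one keeps the product in \<open>tLC_counterexamples\<close> away from 0, and
  the linear bound on \<open>window q k\<close> makes \<open>k\<close> comparable with the length of
  an obstructed word.\<close>

lemma
  assumes "q \<ge> (2::nat)"
  shows window_le: "window q k \<le> 2 * k + 16"
    and power_window_ge: "(k + 1)\<^sup>2 * q ^ 16 \<le> q ^ window q k"
    and power_window_le: "q ^ window q k \<le> (k + 1)\<^sup>2 * q ^ 17"
proof -
  define r where "r = (LEAST r. (k + 1)\<^sup>2 \<le> q ^ r)"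
  have w: "window q k = r + 16" by (simp add: window_def r_def)
  have r: "(k + 1)\<^sup>2 \<le> q ^ r"
    unfolding r_def by (rule LeastI[of _ "2 * k"]) (rule Suc_sq_le_power[OF assms])
  have "r \<le> 2 * k"
    unfolding r_def by (rule Least_le) (rule Suc_sq_le_power[OF assms])
  then show "window q k \<le> 2 * k + 16" by (simp add: w)
  show "(k + 1)\<^sup>2 * q ^ 16 \<le> q ^ window q k"
    using r by (simp add: w power_add)
  have "q ^ r \<le> (k + 1)\<^sup>2 * q"
  proof (cases r)
    case 0
    have "1 * 1 \<le> (k + 1)\<^sup>2 * q" using assms by (intro mult_mono) auto
    then show ?thesis using 0 by simp
  next
    case (Suc r')
    have "\<not> (k + 1)\<^sup>2 \<le> q ^ r'"
      using not_less_Least[of r' "\<lambda>r. (k + 1)\<^sup>2 \<le> q ^ r"] Suc by (simp add: r_def)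
    then have "q ^ r' \<le> (k + 1)\<^sup>2" by simp
    then show ?thesis using Suc by (metis mult.commute mult_le_mono2 power_Suc)
  qed
  then have "q ^ r * q ^ 16 \<le> ((k + 1)\<^sup>2 * q) * q ^ 16" by (intro mult_right_mono) auto
  also have "\<dots> = (k + 1)\<^sup>2 * q ^ 17" using power_add[of q 1 16] by (simp only: mult.assoc) simp
  finally show "q ^ window q k \<le> (k + 1)\<^sup>2 * q ^ 17" by (simp add: w power_add)
qed

definition annihilates :: "'a::field poly \<Rightarrow> 'a list \<Rightarrow> bool" where
  "annihilates N w \<longleftrightarrow>
     (\<forall>p. p + degree N < length w \<longrightarrow> (\<Sum>i\<le>degree N. coeff N i * w ! (p + i)) = 0)"

text \<open>
  The word \<open>w\<close> lists the coefficients of \<open>\<Theta>\<close> from that of the inverse of t on. That \<open>N\<close>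
  annihilates it means that the first \<open>length w - degree N\<close> digits of the fractional part of
  \<open>\<Theta> N\<close> vanish; the length is chosen such that this makes the product in
  \<open>tLC_counterexamples\<close> less than a constant.
\<close>

definition obstructs :: "'a::{field,finite} poly \<Rightarrow> 'a list \<Rightarrow> bool" where
  "obstructs N w \<longleftrightarrow> N \<noteq> 0 \<and> annihilates N w \<and>
     length w + order 0 N = 2 * degree N + window CARD('a) (degree N)"

text \<open>Quantifying over all prefixes, \<open>w\<close> included, makes these sets closed under
  \<open>take\<close>, as Koenig's lemma requires.\<close>

definition good_words :: "'a::{field,finite} list set \<Rightarrow> nat \<Rightarrow> 'a list set" where
  "good_words F n =
     {w. length w = n \<and> (\<forall>i\<le>n. take i w \<notin> F \<and> (\<forall>N. \<not> obstructs N (take i w)))}"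

lemma good_words_subset: "good_words F n \<subseteq> {w. length w = n}"
  by (auto simp: good_words_def)

lemma finite_length_eq: "finite {w :: 'a::finite list. length w = n}"
  using finite_lists_length_eq[of "UNIV :: 'a set" n] by simp

lemma card_length_eq: "card {w :: 'a::finite list. length w = n} = CARD('a) ^ n"
  using card_lists_length_eq[of "UNIV :: 'a set" n] by simp

lemma finite_good_words: "finite (good_words F n)"
  by (rule finite_subset[OF good_words_subset finite_length_eq])

lemma take_good_words:
  assumes "w \<in> good_words F n" "k \<le> n"
  shows "take k w \<in> good_words F k"
  using assms by (auto simp: good_words_def min_def)

section \<open>Linear recurrences and the number of words obstructed by them\<close>

lemma order_le_degree: "N \<noteq> 0 \<Longrightarrow> order a N \<le> degree (N :: 'a::field poly)"
  by (metis order_degree)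

text \<open>The leading coefficient of \<open>N\<close> is nonzero, so the recurrence computes each
  letter from the \<open>degree N\<close> letters before it.\<close>

lemma annihilated_eqI:
  fixes N :: "'a::field poly"
  assumes "N \<noteq> 0" "annihilates N v" "annihilates N w"
    and len: "length v = length w" and pre: "take (degree N) v = take (degree N) w"
  shows "v = w"
proof (rule nth_equalityI[OF len])
  fix i
  show "i < length v \<Longrightarrow> v ! i = w ! i"
  proof (induction i rule: less_induct)
    case (less i)
    show ?case
    proof (cases "i < degree N")
      case True
      then show ?thesis by (metis nth_take pre)
    next
      case False
      define d where "d = degree N"
      define p where "p = i - d"
      have i: "i = p + d" using False by (simp add: p_def d_def)
      have split: "(\<Sum>j\<le>d. coeff N j * u ! (p + j))
          = (\<Sum>j<d. coeff N j * u ! (p + j)) + coeff N d * u ! i" for u :: "'a list"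
        by (simp add: i lessThan_Suc_atMost[symmetric])
      have "(\<Sum>j\<le>d. coeff N j * v ! (p + j)) = (\<Sum>j\<le>d. coeff N j * w ! (p + j))"
        using assms(2,3) less.prems len by (simp add: annihilates_def d_def[symmetric] i)
      moreover have "(\<Sum>j<d. coeff N j * v ! (p + j)) = (\<Sum>j<d. coeff N j * w ! (p + j))"
        using less.IH less.prems by (intro sum.cong) (auto simp: i)
      ultimately have "coeff N d * v ! i = coeff N d * w ! i" by (simp add: split)
      then show ?thesis using assms(1) by (simp add: d_def)
    qed
  qed
qed

lemma
  fixes j k :: nat
  defines "P \<equiv> {N :: 'a::{field,finite} poly. degree N = k \<and> (\<forall>i<j. coeff N i = 0)}"
  shows finite_polys_degree: "finite P" and card_polys_degree_le: "card P \<le> CARD('a) ^ (k + 1 - j)"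
proof -
  define g where "g = (\<lambda>N :: 'a poly. map (coeff N) [j..<k + 1])"
  have inj: "inj_on g P"
  proof (rule inj_onI)
    fix M N assume MN: "M \<in> P" "N \<in> P" "g M = g N"
    show "M = N"
    proof (rule poly_eqI)
      fix i
      have "\<forall>x\<in>set [j..<k + 1]. coeff M x = coeff N x" using MN(3) by (simp only: g_def map_eq_conv)
      then show "coeff M i = coeff N i"
        using MN(1,2) coeff_eq_0[of M i] coeff_eq_0[of N i]
        by (cases "i < j"; cases "i < k + 1") (auto simp: P_def simp del: upt_Suc)
    qed
  qed
  have sub: "g ` P \<subseteq> {w. length w = k + 1 - j}" by (auto simp: g_def)
  show "finite P"
    by (rule finite_imageD[OF finite_subset[OF sub finite_length_eq] inj])
  show "card P \<le> CARD('a) ^ (k + 1 - j)"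
    using card_mono[OF finite_length_eq sub] by (simp add: card_image[OF inj] card_length_eq)
qed

text \<open>Goodness is asked only of the first \<open>k\<close> letters: together with
  \<open>N\<close> they determine the word, so counting reduces to
  \<open>good_words F k\<close>.\<close>

definition obstructed_words :: "'a::{field,finite} list set \<Rightarrow> nat \<Rightarrow> nat \<Rightarrow> 'a list set" where
  "obstructed_words F n k =
     {w. length w = n \<and> take k w \<in> good_words F k \<and> (\<exists>N. degree N = k \<and> obstructs N w)}"

lemma obstructs_lengthD:
  fixes w :: "'a::{field,finite} list"
  assumes "obstructs N w"
  shows "degree N + window CARD('a) (degree N) \<le> length w"
    and "length w \<le> 2 * degree N + window CARD('a) (degree N)"
    and "degree N < length w"
  using assms order_le_degree[of N 0] by (auto simp: obstructs_def window_def)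

text \<open>The length \<open>n\<close> fixes the order of \<open>N\<close> at 0 as
  \<open>j = 2 * k + window q k - n\<close>. Divisibility by the \<open>j\<close>-th power of t
  leaves at most \<open>q ^ (k + 1 - j)\<close> choices of \<open>N\<close>, and for each of them
  the first \<open>k\<close> letters determine the word.\<close>

lemma card_obstructed_words_le:
  fixes F :: "'a::{field,finite} list set"
  defines "q \<equiv> CARD('a)"
  assumes n: "k + window q k \<le> n" "n \<le> 2 * k + window q k"
  shows "card (obstructed_words F n k) \<le> q ^ (n + 1 - k - window q k) * card (good_words F k)"
proof -
  define j where "j = 2 * k + window q k - n"
  define P where "P = {N :: 'a poly. degree N = k \<and> (\<forall>i<j. coeff N i = 0)}"
  define B where "B = (\<lambda>N. {w. length w = n \<and> take k w \<in> good_words F k \<and> obstructs N w})"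
  have "obstructed_words F n k \<subseteq> (\<Union>N\<in>P. B N)"
  proof
    fix w assume "w \<in> obstructed_words F n k"
    then obtain N where N: "degree N = k" "obstructs N w" and w: "length w = n" "take k w \<in> good_words F k"
      by (auto simp: obstructed_words_def)
    have "[:0, 1:] ^ j dvd N"
      using N w n by (intro power_le_dvd[OF order_1[of 0 N, simplified]])
        (auto simp: obstructs_def j_def q_def)
    then have "monom 1 j dvd N" by (simp add: monom_altdef)
    then have "coeff N i = 0" if "i < j" for i using that by (simp add: monom_1_dvd_iff')
    then show "w \<in> (\<Union>N\<in>P. B N)" using N w by (auto simp: P_def B_def)
  qed
  moreover have fin: "finite (B N)" for N
    by (rule finite_subset[OF _ finite_length_eq[of n]]) (auto simp: B_def)
  ultimately have "card (obstructed_words F n k) \<le> card (\<Union>N\<in>P. B N)"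
    by (intro card_mono finite_UN_I) (auto simp: P_def finite_polys_degree)
  also have "\<dots> \<le> (\<Sum>N\<in>P. card (B N))"
    by (intro card_UN_le) (simp add: P_def finite_polys_degree)
  also have "\<dots> \<le> (\<Sum>N\<in>P. card (good_words F k))"
  proof (intro sum_mono card_inj_on_le[where f = "take k"])
    fix N assume "N \<in> P"
    show "inj_on (take k) (B N)"
    proof (rule inj_onI)
      fix v w assume "v \<in> B N" "w \<in> B N" "take k v = take k w"
      then show "v = w" using \<open>N \<in> P\<close>
        by (intro annihilated_eqI[of N v w]) (auto simp: B_def P_def obstructs_def)
    qed
  qed (auto simp: B_def finite_good_words)
  also have "\<dots> = card P * card (good_words F k)" by simp
  also have "\<dots> \<le> q ^ (k + 1 - j) * card (good_words F k)"
    by (intro mult_right_mono) (unfold P_def q_def, rule card_polys_degree_le, simp)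
  also have "k + 1 - j = n + 1 - k - window q k" using n by (simp add: j_def)
  finally show ?thesis .
qed

text \<open>The proper prefixes of a one-letter extension of a good word are already admissible, so
  it can fail only as a whole, by being obstructed or by lying in \<open>F\<close>.\<close>

lemma good_words_extend:
  fixes F :: "'a::{field,finite} list set"
  shows "CARD('a) * card (good_words F n) \<le> card (good_words F (n + 1))
    + (\<Sum>k\<le>n. card (obstructed_words F (n + 1) k)) + card {w \<in> F. length w = n + 1}"
proof -
  define E where "E = (\<lambda>(w, x). w @ [x]) ` (good_words F n \<times> (UNIV :: 'a set))"
  have "card E = card (good_words F n \<times> (UNIV :: 'a set))"
    unfolding E_def by (intro card_image inj_onI) auto
  then have "CARD('a) * card (good_words F n) = card E"
    by (simp add: card_cartesian_product)
  also have "\<dots> \<le> card (good_words F (n + 1) \<union> (\<Union>k\<le>n. obstructed_words F (n + 1) k)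
      \<union> {w \<in> F. length w = n + 1})"
  proof (intro card_mono)
    have "finite (obstructed_words F (n + 1) k)" for k
      by (rule finite_subset[OF _ finite_length_eq[of "n + 1"]]) (auto simp: obstructed_words_def)
    moreover have "finite {w \<in> F. length w = n + 1}"
      by (rule finite_subset[OF _ finite_length_eq[of "n + 1"]]) auto
    ultimately show "finite (good_words F (n + 1) \<union> (\<Union>k\<le>n. obstructed_words F (n + 1) k)
        \<union> {w \<in> F. length w = n + 1})"
      by (auto simp: finite_good_words)
    show "E \<subseteq> good_words F (n + 1) \<union> (\<Union>k\<le>n. obstructed_words F (n + 1) k)
      \<union> {w \<in> F. length w = n + 1}"
    proof
      fix v assume "v \<in> E"
      then obtain w x where v: "v = w @ [x]" and w: "w \<in> good_words F n"
        by (auto simp: E_def)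
      have lw: "length w = n" using w by (simp add: good_words_def)
      have tk: "take i v = take i w" if "i \<le> n" for i using that by (simp add: v lw)
      show "v \<in> good_words F (n + 1) \<union> (\<Union>k\<le>n. obstructed_words F (n + 1) k)
          \<union> {w \<in> F. length w = n + 1}"
      proof (cases "\<exists>N. obstructs N v")
        case True
        then obtain N where N: "obstructs N v" by blast
        have "degree N \<le> n" using obstructs_lengthD(3)[OF N] by (simp add: v lw)
        moreover from this have "take (degree N) v \<in> good_words F (degree N)"
          using take_good_words[OF w] by (simp add: tk)
        ultimately show ?thesis using N by (auto simp: obstructed_words_def v lw)
      next
        case False
        have "v \<in> good_words F (n + 1)" if "v \<notin> F"
          unfolding good_words_def
        proof (intro CollectI conjI allI impI)
          fix i N assume "i \<le> n + 1"
          then consider "i \<le> n" | "i = n + 1" by linarith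
          then show "\<not> obstructs N (take i v)"
            using w False by cases (auto simp: tk good_words_def v lw)
        next
          fix i assume "i \<le> n + 1"
          then consider "i \<le> n" | "i = n + 1" by linarith
          then show "take i v \<notin> F"
            using w that by cases (auto simp: tk good_words_def v lw)
        qed (simp add: v lw)
        then show ?thesis by (auto simp: v lw)
      qed
    qed
  qed
  also have "\<dots> \<le> card (good_words F (n + 1)) + card (\<Union>k\<le>n. obstructed_words F (n + 1) k)
      + card {w \<in> F. length w = n + 1}"
    by (intro order_trans[OF card_Un_le] add_mono card_Un_le order_refl)
  also have "\<dots> \<le> card (good_words F (n + 1)) + (\<Sum>k\<le>n. card (obstructed_words F (n + 1) k))
      + card {w \<in> F. length w = n + 1}"
    by (intro add_mono card_UN_le order_refl) simp
  finally show ?thesis .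
qed

text \<open>The invariant \<open>IH\<close> converts the count of good words of length
  \<open>k\<close> into one of length \<open>n\<close>. It contributes one factor
  \<open>k + 1\<close> and the window two more; as \<open>n + 2\<close> is at most
  \<open>17 * (k + 1)\<close>, these outweigh \<open>(n + 2)\<^sup>2\<close> and the factor
  \<open>n + 1\<close> lost in \<open>IH\<close>.\<close>

lemma obstructed_words_negligible:
  fixes F :: "'a::{field,finite} list set"
  defines "q \<equiv> CARD('a)"
  assumes IH: "(k + 1) * card (good_words F k) * q ^ n \<le> (n + 1) * card (good_words F n) * q ^ k"
  shows "2 * (n + 2)\<^sup>2 * card (obstructed_words F (n + 1) k) \<le> q * card (good_words F n)"
proof (cases "obstructed_words F (n + 1) k = {}")
  case False
  define W where "W = (\<lambda>k. card (good_words F k))"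
  define A where "A = card (obstructed_words F (n + 1) k)"
  define l where "l = window q k"
  have q: "q \<ge> 2" unfolding q_def by (rule card_field_ge_2)
  from False have n: "k + l \<le> n + 1" "n + 1 \<le> 2 * k + l"
    using obstructs_lengthD[where ?'a = 'a] by (fastforce simp: obstructed_words_def l_def q_def)+
  have "A \<le> q ^ (n + 2 - k - l) * W k"
    using card_obstructed_words_le[of k "n + 1" F] n by (simp add: A_def W_def q_def l_def)
  \<comment> \<open>The factor \<open>(k + 1) * q ^ n\<close> prepares for \<open>IH\<close>, and
    \<open>q ^ l\<close> undoes the subtraction of \<open>l\<close> in the exponent.\<close>
  then have "A * ((k + 1) * q ^ n) * q ^ l \<le> q ^ (n + 2 - k - l) * W k * ((k + 1) * q ^ n) * q ^ l"
    by (intro mult_right_mono) auto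
  also have "\<dots> = q ^ (n + 2 - k - l) * q ^ l * ((k + 1) * W k * q ^ n)" by (simp add: algebra_simps)
  also have "\<dots> \<le> q ^ (n + 2 - k - l) * q ^ l * ((n + 1) * W n * q ^ k)"
    using IH by (intro mult_left_mono) (simp_all add: W_def)
  also have "\<dots> = q ^ (n + 2 - k - l + l + k) * ((n + 1) * W n)" by (simp add: power_add algebra_simps)
  also have "n + 2 - k - l + l + k = n + 2" using n by simp
  finally have "q ^ n * (A * (k + 1) * q ^ l) \<le> q ^ n * (q\<^sup>2 * ((n + 1) * W n))"
    by (simp add: algebra_simps power_add power2_eq_square)
  then have 1: "A * (k + 1) * q ^ l \<le> q\<^sup>2 * ((n + 1) * W n)" using q by simp
  have "A * (k + 1) ^ 3 * q ^ 16 = A * (k + 1) * ((k + 1)\<^sup>2 * q ^ 16)"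
    by (simp only: power2_eq_square power3_eq_cube mult_ac)
  also have "\<dots> \<le> A * (k + 1) * q ^ l"
    unfolding l_def by (intro mult_left_mono power_window_ge q) auto
  finally have 2: "A * (k + 1) ^ 3 * q ^ 16 \<le> q\<^sup>2 * ((n + 1) * W n)" using 1 by linarith
  \<comment> \<open>Since \<open>l\<close> is at most \<open>2 * k + 16\<close>, the number
    \<open>n + 2\<close> is at most \<open>4 * k + 17\<close>.\<close>
  have "n + 2 \<le> 17 * (k + 1)" using n(2) window_le[OF q, of k] by (simp add: l_def)
  then have n3: "(n + 2) ^ 3 \<le> (17 * (k + 1)) ^ 3" by (intro power_mono) auto
  have "(k + 1) ^ 3 * (2 * (n + 2)\<^sup>2 * A * q ^ 16) = 2 * (n + 2)\<^sup>2 * (A * (k + 1) ^ 3 * q ^ 16)"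
    by (simp add: algebra_simps)
  also have "\<dots> \<le> 2 * (n + 2)\<^sup>2 * (q\<^sup>2 * ((n + 1) * W n))" using 2 by (intro mult_left_mono) auto
  also have "\<dots> \<le> 2 * (n + 2)\<^sup>2 * (q\<^sup>2 * ((n + 2) * W n))" by (intro mult_left_mono mult_right_mono) auto
  also have "\<dots> = 2 * (n + 2) ^ 3 * q\<^sup>2 * W n" by (simp only: power2_eq_square power3_eq_cube mult_ac)
  also have "\<dots> \<le> 2 * (17 * (k + 1)) ^ 3 * q\<^sup>2 * W n" by (intro mult_right_mono mult_left_mono n3) auto
  also have "\<dots> = (k + 1) ^ 3 * (9826 * q\<^sup>2 * W n)" by (simp only: power_mult_distrib) (simp add: mult_ac)
  finally have "2 * (n + 2)\<^sup>2 * A * q ^ 16 \<le> 9826 * q\<^sup>2 * W n"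
    by (subst (asm) mult_le_cancel1) simp
  \<comment> \<open>Here 9826 is \<open>2 * 17 ^ 3\<close>. It uses up 15 factors \<open>q\<close>;
    since 15 + 2 = 1 + 16, exactly one \<open>q\<close> is left after cancelling
    \<open>q ^ 16\<close>.\<close>
  also have "\<dots> \<le> q ^ 15 * q\<^sup>2 * W n"
  proof (intro mult_right_mono)
    have "(9826::nat) \<le> 2 ^ 15" by simp
    also have "\<dots> \<le> q ^ 15" using q by (intro power_mono) auto
    finally show "9826 \<le> q ^ 15" .
  qed auto
  also have "q ^ 15 * q\<^sup>2 * W n = q * W n * q ^ 16" by (simp add: eval_nat_numeral)
  finally have "2 * (n + 2)\<^sup>2 * A \<le> q * W n"
    using q by (subst (asm) mult_le_cancel2) simp
  then show ?thesis by (simp only: A_def W_def)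
qed simp

text \<open>The invariant says that \<open>(n + 1) |good_words n| / q ^ n\<close> is nondecreasing in \<open>n\<close>.\<close>

lemma good_words_growth:
  fixes F :: "'a::{field,finite} list set"
  defines "q \<equiv> CARD('a)"
  assumes F0: "[] \<notin> F"
    and F: "\<And>n. 2 * (n + 1) * (n + 2) * card {w \<in> F. length w = n + 1} \<le> q ^ (n + 1)"
    and "k \<le> n"
  shows "(k + 1) * card (good_words F k) * q ^ n \<le> (n + 1) * card (good_words F n) * q ^ k"
  using \<open>k \<le> n\<close>
proof (induction n arbitrary: k)
  case 0
  then show ?case by simp
next
  case (Suc n)
  define W where "W = (\<lambda>k. card (good_words F k))"
  define A where "A = (\<lambda>k. card (obstructed_words F (n + 1) k))"
  define f where "f = card {w \<in> F. length w = n + 1}"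
  have q: "q \<ge> 2" unfolding q_def by (rule card_field_ge_2)
  have "\<not> obstructs N []" for N :: "'a poly" using obstructs_lengthD(3)[of N "[]"] by auto
  then have "good_words F 0 = {[]}" using F0 by (auto simp: good_words_def)
  \<comment> \<open>This case \<open>k = 0\<close> of the invariant turns the absolute bound on
    \<open>F\<close> into one relative to \<open>W n\<close>.\<close>
  then have Wn: "q ^ n \<le> (n + 1) * W n" using Suc.IH[of 0] by (simp add: W_def)
  have ext: "q * W n \<le> W (n + 1) + (\<Sum>k\<le>n. A k) + f"
    unfolding q_def W_def A_def f_def by (rule good_words_extend)
  \<comment> \<open>There are \<open>n + 1\<close> values of \<open>k\<close>, so together they
    remove at most a proportion \<open>1 / (2 * (n + 2))\<close> of the extensions.\<close>
  have "2 * (n + 2)\<^sup>2 * (\<Sum>k\<le>n. A k) = (\<Sum>k\<le>n. 2 * (n + 2)\<^sup>2 * A k)"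
    by (simp add: sum_distrib_left)
  also have "\<dots> \<le> (\<Sum>k\<le>n. q * W n)"
    unfolding A_def W_def q_def
    by (intro sum_mono obstructed_words_negligible Suc.IH[unfolded q_def]) simp
  also have "\<dots> \<le> (n + 2) * (q * W n)" by simp
  finally have "(n + 2) * (2 * (n + 2) * (\<Sum>k\<le>n. A k)) \<le> (n + 2) * (q * W n)"
    by (simp only: power2_eq_square mult_ac)
  then have sA: "2 * (n + 2) * (\<Sum>k\<le>n. A k) \<le> q * W n" by (subst (asm) mult_le_cancel1) simp
  have "(n + 1) * (2 * (n + 2) * f) \<le> q * q ^ n"
    using F[of n] unfolding f_def[symmetric] by (simp only: power_Suc Suc_eq_plus1[symmetric] mult_ac)
  also have "\<dots> \<le> q * ((n + 1) * W n)" by (intro mult_left_mono Wn) simp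
  finally have "(n + 1) * (2 * (n + 2) * f) \<le> (n + 1) * (q * W n)" by (simp only: mult_ac)
  then have sf: "2 * (n + 2) * f \<le> q * W n" by (subst (asm) mult_le_cancel1) simp
  \<comment> \<open>Obstructions and \<open>F\<close> each cost at most half of
    \<open>q * W n / (n + 2)\<close>; the remaining proportion \<open>(n + 1) / (n + 2)\<close> is
    what the invariant needs.\<close>
  have "2 * (n + 2) * (q * W n) \<le> 2 * (n + 2) * (W (n + 1) + (\<Sum>k\<le>n. A k) + f)"
    by (intro mult_left_mono ext) simp
  also have "\<dots> \<le> 2 * (n + 2) * W (n + 1) + 2 * (q * W n)"
    using sA sf by (simp only: distrib_left)
  finally have step: "(n + 1) * W n * q \<le> (n + 2) * W (n + 1)" by (simp add: algebra_simps)
  show ?case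
  proof (cases "k = Suc n")
    case False
    then have "k \<le> n" using Suc.prems by simp
    have "(k + 1) * W k * q ^ Suc n = q * ((k + 1) * W k * q ^ n)" by (simp add: mult_ac)
    also have "\<dots> \<le> q * ((n + 1) * W n * q ^ k)"
      using Suc.IH[OF \<open>k \<le> n\<close>] by (intro mult_left_mono) (simp_all add: W_def)
    also have "\<dots> = (n + 1) * W n * q * q ^ k" by (simp add: mult_ac)
    also have "\<dots> \<le> (n + 2) * W (n + 1) * q ^ k" by (intro mult_right_mono step) simp
    finally show ?thesis by (simp add: W_def)
  qed simp
qed

section \<open>Infinite words all of whose prefixes are good\<close>

text \<open>Koenig's lemma: a word that extends to every later level has a one-letter prolongation
  with the same property, because there are only finitely many prolongations.\<close>

lemma koenig_branch:
  fixes T :: "nat \<Rightarrow> 'a::finite list set"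
  assumes ne: "\<And>n. T n \<noteq> {}"
    and len: "\<And>n w. w \<in> T n \<Longrightarrow> length w = n"
    and pre: "\<And>k n w. w \<in> T n \<Longrightarrow> k \<le> n \<Longrightarrow> take k w \<in> T k"
  shows "\<exists>b. \<forall>n. map b [0..<n] \<in> T n"
proof -
  define ext where "ext = (\<lambda>w n. \<forall>m\<ge>n. \<exists>v\<in>T m. take n v = w)"
  have step: "\<exists>w'. ext w' (Suc n) \<and> take n w' = w" if w: "ext w n" for w n
  proof (rule ccontr)
    assume *: "\<not> ?thesis"
    define S where "S = {w' :: 'a list. length w' = Suc n \<and> take n w' = w}"
    have fin: "finite S" 
      by (rule finite_subset[OF _ finite_length_eq[of "Suc n"]]) (auto simp: S_def)
    have "\<forall>w'\<in>S. \<exists>m\<ge>Suc n. \<forall>v\<in>T m. take (Suc n) v \<noteq> w'" using * by (auto simp: ext_def S_def)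
    then obtain g where g: "\<And>w'. w' \<in> S \<Longrightarrow> g w' \<ge> Suc n \<and> (\<forall>v\<in>T (g w'). take (Suc n) v \<noteq> w')"
      by metis
    \<comment> \<open>If each prolongation dies at some level, all are dead at level
      \<open>m\<close>, where \<open>w\<close> still has an extension. Inserting
      \<open>Suc n\<close> ensures that \<open>m\<close> is at least \<open>Suc n\<close>.\<close>
    define m where "m = Max (insert (Suc n) (g ` S))"
    have m: "m \<ge> Suc n" "\<And>w'. w' \<in> S \<Longrightarrow> g w' \<le> m" using fin by (auto simp: m_def)
    obtain v where v: "v \<in> T m" "take n v = w" using w m(1) unfolding ext_def by (meson Suc_leD)
    have S: "take (Suc n) v \<in> S" using len[OF v(1)] m(1) v(2) by (auto simp: S_def min_def)
    have "take (g (take (Suc n) v)) v \<in> T (g (take (Suc n) v))" using pre[OF v(1)] m(2)[OF S] .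
    moreover have "take (Suc n) (take (g (take (Suc n) v)) v) = take (Suc n) v"
      using g[OF S] by (simp add: min_def)
    ultimately show False using g[OF S] by blast
  qed
  have "ext [] 0" using ne by (auto simp: ext_def ex_in_conv)
  then obtain W where W: "\<And>n. ext (W n) n" "\<And>n. take n (W (Suc n)) = W n"
    using dependent_nat_choice[of "\<lambda>n w. ext w n" "\<lambda>n w w'. take n w' = w"] step by blast
  have WT: "W n \<in> T n" for n using W(1)[of n] len unfolding ext_def by (metis order_refl take_all)
  have lW: "length (W n) = n" for n using len[OF WT] .
  define b where "b = (\<lambda>n. W (Suc n) ! n)"
  have "map b [0..<n] = W n" for n
  proof (induction n)
    case 0
    then show ?case using lW[of 0] by simp
  next
    case (Suc n)
    have "W (Suc n) = take n (W (Suc n)) @ [W (Suc n) ! n]"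
      using take_Suc_conv_app_nth[of n "W (Suc n)"] lW[of "Suc n"] by simp
    then show ?case using Suc W(2)[of n] by (simp add: b_def)
  qed
  then have "\<forall>n. map b [0..<n] \<in> T n" using WT by simp
  then show ?thesis by blast
qed

text \<open>Growth from length 0 gives \<open>q ^ n \<le> (n + 1) * card (good_words F n)\<close>,
  where \<open>q\<close> is \<open>CARD('a)\<close>, so no level of the tree is empty.\<close>

lemma good_sequence_exists:
  fixes F :: "'a::{field,finite} list set"
  assumes F0: "[] \<notin> F"
    and F: "\<And>n. 2 * (n + 1) * (n + 2) * card {w \<in> F. length w = n + 1} \<le> CARD('a) ^ (n + 1)"
  obtains b where "\<And>n. map b [0..<n] \<notin> F" "\<And>n N. \<not> obstructs N (map b [0..<n])"
proof -
  have "good_words F n \<noteq> {}" for n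
  proof
    assume e: "good_words F n = {}"
    have "\<not> obstructs N []" for N :: "'a poly" using obstructs_lengthD(3)[of N "[]"] by auto
    then have "good_words F 0 = {[]}" using F0 by (auto simp: good_words_def)
    then show False using good_words_growth[OF F0 F, of 0 n] e by simp
  qed
  moreover have "length w = n" if "w \<in> good_words F n" for w n
    using that by (simp add: good_words_def)
  ultimately have "\<exists>b. \<forall>n. map b [0..<n] \<in> good_words F n"
    using take_good_words by (rule koenig_branch)
  then obtain b where b: "\<And>n. map b [0..<n] \<in> good_words F n" by blast
  show ?thesis
  proof (rule that)
    show "map b [0..<n] \<notin> F" for n
      using b[of n] unfolding good_words_def by (auto dest!: spec[of _ n])
    show "\<not> obstructs N (map b [0..<n])" for n N
      using b[of n] unfolding good_words_def by (auto dest!: spec[of _ n])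
  qed
qed

section \<open>Digits of Laurent series\<close>

text \<open>Multiplication by t shifts the coefficients, so those of the product are the sums in
  \<open>annihilates\<close>.\<close>

lemma fls_nth_times_of_poly:
  fixes N :: "'a::field poly"
  shows "fls_nth (\<Theta> * fls_of_poly N) n = (\<Sum>i\<le>degree N. coeff N i * fls_nth \<Theta> (n + int i))"
proof (induction N arbitrary: n)
  case 0
  then show ?case by (simp add: fls_of_poly_def)
next
  case (pCons a N)
  have "fls_of_poly (pCons a N) = fls_const a + fls_X_inv * fls_of_poly N"
    using pCons(1) by (simp add: fls_of_poly_def map_poly_pCons)
  then have "\<Theta> * fls_of_poly (pCons a N) = fls_const a * \<Theta> + fls_X_inv * (\<Theta> * fls_of_poly N)"
    by (simp add: algebra_simps)
  then have eq: "fls_nth (\<Theta> * fls_of_poly (pCons a N)) n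
      = a * fls_nth \<Theta> n + (\<Sum>i\<le>degree N. coeff N i * fls_nth \<Theta> (n + 1 + int i))"
    by (simp add: fls_X_inv_times_conv_shift(1) pCons.IH)
  show ?case
  proof (cases "N = 0")
    case False
    then show ?thesis
      by (simp add: eq sum.atMost_Suc_shift algebra_simps del: sum.atMost_Suc)
  qed (use eq in simp)
qed

text \<open>Letters are numbered from 0, negative powers of t from 1; hence the shift, which
  \<open>digits\<close> undoes.\<close>

definition series_of :: "(nat \<Rightarrow> 'a::field) \<Rightarrow> 'a fls" where
  "series_of b = fps_to_fls (Abs_fps (\<lambda>i. if i \<ge> 1 then b (i - 1) else 0))"

lemma fls_nth_series_of: "fls_nth (series_of b) n = (if n \<ge> 1 then b (nat n - 1) else 0)"
  by (auto simp: series_of_def nat_le_eq_zle)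

definition digits :: "'a::field fls \<Rightarrow> nat \<Rightarrow> 'a" where
  "digits \<Theta> i = fls_nth \<Theta> (int i + 1)"

lemma digits_series_of: "digits (series_of b) = b"
  by (auto simp: digits_def fls_nth_series_of nat_add_distrib)

lemma laurent_abs_nonneg: "laurent_abs \<Theta> \<ge> 0"
  by (simp add: laurent_abs_def)

lemma laurent_abs_ge:
  fixes \<Theta> :: "'a::{field,finite} fls"
  assumes "fls_nth \<Theta> n \<noteq> 0"
  shows "laurent_abs \<Theta> \<ge> real CARD('a) powi (- n)"
proof -
  have "fls_subdegree \<Theta> \<le> n" using assms fls_eq0_below_subdegree[of n \<Theta>] by linarith
  then have "real CARD('a) powi (- n) \<le> real CARD('a) powi (- fls_subdegree \<Theta>)"
    using card_field_ge_2[where ?'a = 'a] by (intro power_int_increasing) auto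
  then show ?thesis using assms by (auto simp: laurent_abs_def)
qed

lemma laurent_abs_le:
  fixes \<Theta> :: "'a::{field,finite} fls"
  assumes "\<And>i. i < n \<Longrightarrow> fls_nth \<Theta> i = 0"
  shows "laurent_abs \<Theta> \<le> real CARD('a) powi (- n)"
proof (cases "\<Theta> = 0")
  case False
  have "n \<le> fls_subdegree \<Theta>" using False assms by (rule fls_subdegree_geI)
  then have "real CARD('a) powi (- fls_subdegree \<Theta>) \<le> real CARD('a) powi (- n)"
    using card_field_ge_2[where ?'a = 'a] by (intro power_int_increasing) auto
  then show ?thesis using False by (auto simp: laurent_abs_def)
qed (simp add: laurent_abs_def)

lemma unit_interval_iff:
  fixes \<Theta> :: "'a::{field,finite} fls"
  shows "\<Theta> \<in> unit_interval \<longleftrightarrow> (\<forall>i\<le>0. fls_nth \<Theta> i = 0)"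
proof
  assume *: "\<Theta> \<in> unit_interval"
  show "\<forall>i\<le>0. fls_nth \<Theta> i = 0"
  proof (intro allI impI)
    fix i :: int assume "i \<le> 0"
    show "fls_nth \<Theta> i = 0"
    proof (rule ccontr)
      assume "fls_nth \<Theta> i \<noteq> 0"
      then have "real CARD('a) powi (- i) < 1"
        using laurent_abs_ge[of \<Theta> i] * by (simp add: unit_interval_def)
      moreover have "1 \<le> real CARD('a) powi (- i)"
        using card_field_ge_2[where ?'a = 'a] \<open>i \<le> 0\<close> by (intro one_le_power_int) auto
      ultimately show False by simp
    qed
  qed
next
  assume "\<forall>i\<le>0. fls_nth \<Theta> i = 0"
  then have "laurent_abs \<Theta> \<le> real CARD('a) powi (- 1)" by (intro laurent_abs_le) auto
  also have "\<dots> < 1" using card_field_ge_2[where ?'a = 'a] by (simp add: power_int_minus field_simps)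
  finally show "\<Theta> \<in> unit_interval" by (simp add: unit_interval_def)
qed

lemma series_of_in_unit_interval: "series_of b \<in> unit_interval"
  by (simp add: unit_interval_iff fls_nth_series_of)

text \<open>With \<open>digits_eq_of_laurent_dist_less\<close> this identifies cylinders with balls:
  in the unit interval, distance below \<open>1 / q ^ n\<close>, agreement of \<open>n\<close>
  digits and distance at most \<open>1 / q ^ (n + 1)\<close> are equivalent.\<close>

lemma laurent_dist_le_of_digits_eq:
  fixes \<Theta> \<Phi> :: "'a::{field,finite} fls"
  assumes "\<Theta> \<in> unit_interval" "\<Phi> \<in> unit_interval"
    and eq: "map (digits \<Theta>) [0..<n] = map (digits \<Phi>) [0..<n]"
  shows "laurent_dist \<Theta> \<Phi> \<le> 1 / real CARD('a) ^ (n + 1)"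
proof -
  have "fls_nth (\<Theta> - \<Phi>) i = 0" if "i < int (n + 1)" for i
  proof (cases "i \<le> 0")
    case True
    then show ?thesis using assms(1,2) by (simp add: unit_interval_iff)
  next
    case False
    define m where "m = nat i - 1"
    have "m < n" and i: "i = int m + 1" using False that by (auto simp: m_def)
    then have "digits \<Theta> m = digits \<Phi> m" using eq unfolding map_eq_conv by simp
    then show ?thesis by (simp add: digits_def i)
  qed
  then have "laurent_abs (\<Theta> - \<Phi>) \<le> real CARD('a) powi (- int (n + 1))" by (rule laurent_abs_le)
  then show ?thesis by (simp only: laurent_dist_def power_int_minus power_int_of_nat inverse_eq_divide)
qed

lemma digits_eq_of_laurent_dist_less:
  fixes \<Theta> \<Phi> :: "'a::{field,finite} fls"
  assumes "laurent_dist \<Theta> \<Phi> < 1 / real CARD('a) ^ n"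
  shows "map (digits \<Theta>) [0..<n] = map (digits \<Phi>) [0..<n]"
proof -
  have "digits \<Theta> i = digits \<Phi> i" if "i < n" for i
  proof (rule ccontr)
    assume "digits \<Theta> i \<noteq> digits \<Phi> i"
    then have "fls_nth (\<Theta> - \<Phi>) (int i + 1) \<noteq> 0" by (simp add: digits_def)
    then have "real CARD('a) powi (- (int i + 1)) \<le> laurent_dist \<Theta> \<Phi>"
      unfolding laurent_dist_def by (rule laurent_abs_ge)
    moreover have "real CARD('a) powi (- int n) \<le> real CARD('a) powi (- (int i + 1))"
      using that card_field_ge_2[where ?'a = 'a] by (intro power_int_increasing) auto
    ultimately show False using assms by (simp add: power_int_minus inverse_eq_divide)
  qed
  then show ?thesis by simp
qed

lemma laurent_dist_nonneg: "laurent_dist \<Theta> \<Phi> \<ge> 0"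
  by (simp add: laurent_dist_def laurent_abs_nonneg)

text \<open>Let \<open>N\<close> have degree \<open>k\<close> and order \<open>j\<close> at 0. Some
  digit of the fractional part among the first \<open>k - j + l\<close> is nonzero, so the product
  is at least \<open>L * q ^ k / q ^ (k - j + l) / q ^ j = L / q ^ l\<close>, and
  \<open>q ^ l\<close> has the order of \<open>L\<close>.\<close>

lemma unobstructed_imp_counterexample:
  fixes b :: "nat \<Rightarrow> 'a::{field,finite}"
  assumes unobs: "\<And>n N. \<not> obstructs N (map b [0..<n])"
  shows "series_of b \<in> tLC_counterexamples (log_sq (real CARD('a)))"
proof -
  define q where "q = CARD('a)"
  have q: "q \<ge> 2" unfolding q_def by (rule card_field_ge_2)
  define \<Theta> where "\<Theta> = series_of b"
  \<comment> \<open>The exponent 17 comes from \<open>power_window_le\<close>, the 4 from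
    \<open>(k + 1)\<^sup>2 \<le> 4 * L\<close> below.\<close>
  define c where "c = 1 / (4 * real q ^ 17)"
  have c: "c > 0" using q by (simp add: c_def)
  have lower: "c \<le> log_sq (real CARD('a)) (laurent_abs (fls_of_poly N)) * laurent_abs (fls_of_poly N)
             * laurent_abs (frac_part (\<Theta> * fls_of_poly N)) * t_adic_abs N"
    if "N \<noteq> 0" for N :: "'a poly"
  proof -
    define k where "k = degree N"
    define j where "j = order 0 N"
    define l where "l = window q k"
    have jk: "j \<le> k" using that by (simp add: j_def k_def order_le_degree)
    \<comment> \<open>At this length \<open>obstructs\<close> reduces to annihilation.\<close>
    define n where "n = k + (k - j) + l"
    have "\<not> annihilates N (map b [0..<n])"
      using unobs[of N n] that jk by (simp add: obstructs_def n_def l_def k_def j_def q_def)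
    then obtain p where p: "p + k < n" "(\<Sum>i\<le>k. coeff N i * map b [0..<n] ! (p + i)) \<noteq> 0"
      by (auto simp: annihilates_def k_def)
    have "fls_nth (frac_part (\<Theta> * fls_of_poly N)) (int p + 1)
        = (\<Sum>i\<le>k. coeff N i * fls_nth \<Theta> (int p + 1 + int i))"
      by (simp add: fls_nth_frac_part fls_nth_times_of_poly k_def)
    also have "\<dots> = (\<Sum>i\<le>k. coeff N i * map b [0..<n] ! (p + i))"
    proof (rule sum.cong)
      fix i assume "i \<in> {..k}"
      then have "p + i < n" using p(1) by simp
      moreover have "nat (int p + 1 + int i) - 1 = p + i" by linarith
      ultimately show "coeff N i * fls_nth \<Theta> (int p + 1 + int i)
          = coeff N i * map b [0..<n] ! (p + i)"
        by (simp add: \<Theta>_def fls_nth_series_of)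
    qed simp
    finally have "real q powi (- (int p + 1)) \<le> laurent_abs (frac_part (\<Theta> * fls_of_poly N))"
      using p(2) unfolding q_def by (intro laurent_abs_ge) auto
    moreover have "real q powi (- int (k - j + l)) \<le> real q powi (- (int p + 1))"
      using p(1) q jk by (intro power_int_increasing) (auto simp: n_def)
    ultimately have "real q powi (- int (k - j + l)) \<le> laurent_abs (frac_part (\<Theta> * fls_of_poly N))"
      by linarith
    then have frac: "1 / real q ^ (k - j + l) \<le> laurent_abs (frac_part (\<Theta> * fls_of_poly N))"
      by (simp only: power_int_minus power_int_of_nat inverse_eq_divide)
    \<comment> \<open>The value 1 at \<open>k = 0\<close> is the convention f(1) = 1; without it
      constant \<open>N\<close> would give the product 0.\<close>
    define L where "L = (if k = 0 then 1 else real k ^ 2)"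
    have L: "real (k + 1) ^ 2 \<le> 4 * L"
    proof (cases "k = 0")
      case False
      have "real (k + 1) ^ 2 \<le> (2 * real k) ^ 2" using False by (intro power_mono) auto
      then show ?thesis using False by (simp add: L_def power_mult_distrib)
    qed (simp add: L_def)
    have "L \<ge> 0" by (simp add: L_def)
    have logN: "log_sq (real CARD('a)) (laurent_abs (fls_of_poly N)) = L"
      using laurent_abs_fls_of_poly[OF that] log_sq_power[of "real CARD('a)" k] q
      by (simp add: L_def k_def q_def)
    have absN: "laurent_abs (fls_of_poly N) = real q ^ k"
      using laurent_abs_fls_of_poly[OF that] by (simp add: k_def q_def)
    have tN: "t_adic_abs N = 1 / real q ^ j"
      using t_adic_abs_altdef[OF that] by (simp add: q_def j_def power_int_minus inverse_eq_divide)
    have "real q ^ l \<le> real ((k + 1)\<^sup>2 * q ^ 17)"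
      unfolding l_def of_nat_power[symmetric] of_nat_le_iff by (rule power_window_le[OF q])
    also have "\<dots> = real (k + 1) ^ 2 * real q ^ 17" by simp
    also have "\<dots> \<le> 4 * L * real q ^ 17" by (intro mult_right_mono L) simp
    finally have "c \<le> L / real q ^ l" using q by (simp add: c_def field_simps)
    also have "\<dots> = L * real q ^ k * (1 / real q ^ (k - j + l)) * (1 / real q ^ j)"
    proof -
      have "real q ^ k = real q ^ (k - j) * real q ^ j" using jk by (simp add: power_add[symmetric])
      then show ?thesis using q by (simp add: power_add)
    qed
    also have "\<dots> \<le> L * real q ^ k * laurent_abs (frac_part (\<Theta> * fls_of_poly N)) * (1 / real q ^ j)"
      using \<open>L \<ge> 0\<close> by (intro mult_right_mono mult_left_mono frac) auto
    finally show ?thesis unfolding logN unfolding absN tN .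
  qed
  have "c \<le> (INF N \<in> UNIV - {0}. log_sq (real CARD('a)) (laurent_abs (fls_of_poly N))
      * laurent_abs (fls_of_poly N) * laurent_abs (frac_part (\<Theta> * fls_of_poly N)) * t_adic_abs N)"
  proof (rule cINF_greatest)
    have "1 \<in> UNIV - {0 :: 'a poly}" by simp
    then show "UNIV - {0 :: 'a poly} \<noteq> {}" by blast
  qed (use lower in auto)
  then show ?thesis
    using c series_of_in_unit_interval[of b] by (simp add: tLC_counterexamples_def \<Theta>_def)
qed

text \<open>The words in \<open>F\<close> encode cylinders: few enough of them cannot cover the counterexamples.\<close>

lemma counterexample_avoiding:
  fixes F :: "'a::{field,finite} list set"
  assumes "[] \<notin> F"
    and "\<And>n. 2 * (n + 1) * (n + 2) * card {w \<in> F. length w = n + 1} \<le> CARD('a) ^ (n + 1)"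
  shows "\<exists>\<Theta>\<in>tLC_counterexamples (log_sq (real CARD('a))). \<forall>n. map (digits \<Theta>) [0..<n] \<notin> F"
proof -
  from good_sequence_exists[OF assms] obtain b where
    "\<And>n. map b [0..<n] \<notin> F" "\<And>n N. \<not> obstructs N (map b [0..<n])" by metis
  then show ?thesis
    using unobstructed_imp_counterexample[of b]
    by (intro bexI[of _ "series_of b"]) (simp_all add: digits_series_of)
qed

section \<open>Hausdorff dimension\<close>

lemma diam_le:
  assumes "U \<noteq> {}" "\<And>x y. x \<in> U \<Longrightarrow> y \<in> U \<Longrightarrow> d x y \<le> r"
  shows "diam d U \<le> r"
  unfolding diam_def using assms by (intro cSUP_least) auto

lemma diam_ge:
  assumes "\<And>x y. x \<in> U \<Longrightarrow> y \<in> U \<Longrightarrow> d x y \<le> r" "x \<in> U" "y \<in> U"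
  shows "d x y \<le> diam d U"
proof -
  have "bdd_above ((\<lambda>(x, y). d x y) ` (U \<times> U))"
    using assms(1) by (intro bdd_aboveI[of _ r]) auto
  then have "(\<lambda>(x, y). d x y) (x, y) \<le> diam d U"
    unfolding diam_def using assms(2,3) by (intro cSUP_upper) auto
  then show ?thesis by simp
qed

lemma hausdorff_measure_eq_0I:
  assumes "\<And>\<delta> \<epsilon>. \<delta> > 0 \<Longrightarrow> \<epsilon> > 0 \<Longrightarrow>
    \<exists>U\<in>delta_covers d \<delta> E. (\<Sum>i. diam_powr d s (U i)) \<le> ennreal \<epsilon>"
  shows "hausdorff_measure d s E = 0"
proof -
  have "(INF U\<in>delta_covers d \<delta> E. \<Sum>i. diam_powr d s (U i)) = 0" if "\<delta> > 0" for \<delta>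
  proof -
    have "(INF U\<in>delta_covers d \<delta> E. \<Sum>i. diam_powr d s (U i)) \<le> 0"
    proof (rule ennreal_le_epsilon)
      fix \<epsilon> :: real assume "\<epsilon> > 0"
      from assms[OF that this] obtain U where
        "U \<in> delta_covers d \<delta> E" "(\<Sum>i. diam_powr d s (U i)) \<le> ennreal \<epsilon>" ..
      then have "(INF U\<in>delta_covers d \<delta> E. \<Sum>i. diam_powr d s (U i)) \<le> ennreal \<epsilon>"
        by (intro INF_lower2[where f = "\<lambda>U. \<Sum>i. diam_powr d s (U i)"])
      then show "(INF U\<in>delta_covers d \<delta> E. \<Sum>i. diam_powr d s (U i)) \<le> 0 + ennreal \<epsilon>"
        by simp
    qed
    then show ?thesis by simp
  qed
  then have "hausdorff_measure d s E \<le> 0"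
    unfolding hausdorff_measure_def by (intro SUP_least) auto
  then show ?thesis by simp
qed

lemma hausdorff_measure_eq_0D:
  assumes "hausdorff_measure d s E = 0" "\<delta> > 0" "\<epsilon> > 0"
  obtains U where "U \<in> delta_covers d \<delta> E" "(\<Sum>i. diam_powr d s (U i)) < ennreal \<epsilon>"
proof -
  have "(INF U\<in>delta_covers d \<delta> E. \<Sum>i. diam_powr d s (U i)) \<le> hausdorff_measure d s E"
    unfolding hausdorff_measure_def using assms(2) by (intro SUP_upper) auto
  also have "\<dots> < ennreal \<epsilon>" using assms(1,3) by simp
  finally show ?thesis using that by (auto simp: INF_less_iff)
qed

section \<open>Upper bound for the dimension\<close>

text \<open>The \<open>q ^ n\<close> cylinders of length \<open>n\<close> have diameter at most
  \<open>1 / q ^ (n + 1)\<close>, so their s-th powers add up to at most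
  \<open>q powr ((1 - s) * n)\<close>, which tends to 0.\<close>

lemma hausdorff_measure_unit_interval_eq_0:
  fixes E :: "'a::{field,finite} fls set"
  assumes "s > 1" "E \<subseteq> unit_interval"
  shows "hausdorff_measure laurent_dist s E = 0"
proof (rule hausdorff_measure_eq_0I)
  fix \<delta> \<epsilon> :: real assume pos: "\<delta> > 0" "\<epsilon> > 0"
  define q where "q = CARD('a)"
  have q: "q \<ge> 2" unfolding q_def by (rule card_field_ge_2)
  define x where "x = real q powr (1 - s)"
  have "x < real q powr 0" unfolding x_def using q assms(1) by (intro powr_less_mono) auto
  then have x: "0 \<le> x" "x < 1" using q by (auto simp: x_def)
  have "(\<lambda>n. x ^ n) \<longlonglongrightarrow> 0" using x by (intro LIMSEQ_realpow_zero) auto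
  moreover have "(\<lambda>n. (1 / real q) ^ n) \<longlonglongrightarrow> 0" using q by (intro LIMSEQ_realpow_zero) auto
  ultimately have "\<forall>\<^sub>F n in sequentially. x ^ n < \<epsilon> \<and> (1 / real q) ^ n < \<delta>"
    using pos by (intro eventually_conj order_tendstoD)
  then obtain n where n: "x ^ n < \<epsilon>" "(1 / real q) ^ n < \<delta>"
    unfolding eventually_sequentially by blast
  obtain g where g: "bij_betw g {0..<q ^ n} {w :: 'a list. length w = n}"
    using ex_bij_betw_nat_finite[OF finite_length_eq[of n]]
    by (auto simp: card_length_eq q_def)
  define r where "r = 1 / real q ^ (n + 1)"
  have r: "r \<ge> 0" "r \<le> \<delta>"
  proof -
    have "r \<le> 1 / real q ^ n" unfolding r_def using q by (intro divide_left_mono) auto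
    then show "r \<le> \<delta>" using n(2) by (simp add: power_divide)
  qed (simp add: r_def)
  \<comment> \<open>The finite cover is padded with empty sets, which contribute 0 to the
    series.\<close>
  define U where "U = (\<lambda>i. if i < q ^ n
    then {\<Theta> \<in> unit_interval. map (digits \<Theta>) [0..<n] = g i} else {})"
  have dU: "laurent_dist \<Theta> \<Phi> \<le> r" if "\<Theta> \<in> U i" "\<Phi> \<in> U i" for \<Theta> \<Phi> i
    unfolding r_def q_def using that
    by (intro laurent_dist_le_of_digits_eq) (simp_all add: U_def del: map_eq_conv split: if_splits)
  have "E \<subseteq> (\<Union>i. U i)"
  proof
    fix \<Theta> assume "\<Theta> \<in> E"
    have "map (digits \<Theta>) [0..<n] \<in> g ` {0..<q ^ n}"
      using g by (simp add: bij_betw_def)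
    then obtain i where "i < q ^ n" "map (digits \<Theta>) [0..<n] = g i" by auto
    then have "\<Theta> \<in> U i" using \<open>\<Theta> \<in> E\<close> assms(2) by (auto simp: U_def)
    then show "\<Theta> \<in> (\<Union>i. U i)" by blast
  qed
  then have cover: "U \<in> delta_covers laurent_dist \<delta> E"
    using order_trans[OF dU r(2)] by (simp add: delta_covers_def)
  have "(\<Sum>i. diam_powr laurent_dist s (U i)) = (\<Sum>i<q ^ n. diam_powr laurent_dist s (U i))"
    by (intro suminf_finite) (auto simp: U_def diam_powr_def)
  also have "\<dots> \<le> (\<Sum>i<q ^ n. ennreal (r powr s))"
  proof (intro sum_mono)
    fix i
    show "diam_powr laurent_dist s (U i) \<le> ennreal (r powr s)"
    proof (cases "U i = {}")
      case False
      then obtain \<Theta> where \<Theta>: "\<Theta> \<in> U i" by blast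
      have "0 \<le> diam laurent_dist (U i)"
        using diam_ge[of "U i" laurent_dist r \<Theta> \<Theta>] dU \<Theta> laurent_dist_nonneg[of \<Theta> \<Theta>] by fastforce
      moreover have "diam laurent_dist (U i) \<le> r" using False dU by (rule diam_le)
      ultimately show ?thesis
        using False assms(1) by (auto simp: diam_powr_def intro!: ennreal_leI powr_mono2)
    qed (simp add: diam_powr_def)
  qed
  also have "\<dots> = ennreal (real (q ^ n) * r powr s)"
    by (simp add: ennreal_mult'' ennreal_of_nat_eq_real_of_nat)
  also have "\<dots> \<le> ennreal \<epsilon>"
  proof (rule ennreal_leI)
    have "real (q ^ n) * r powr s = real q powr (real n - real (n + 1) * s)"
      using q by (simp add: r_def powr_divide powr_diff powr_realpow[symmetric] powr_powr del: power_Suc)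
    also have "\<dots> \<le> real q powr ((1 - s) * real n)"
      using q assms(1) by (intro powr_mono) (auto simp: algebra_simps)
    also have "\<dots> = x ^ n" using q by (simp add: x_def powr_powr[symmetric] powr_realpow)
    finally show "real (q ^ n) * r powr s \<le> \<epsilon>" using n(1) by simp
  qed
  finally show "\<exists>U\<in>delta_covers laurent_dist \<delta> E. (\<Sum>i. diam_powr laurent_dist s (U i)) \<le> ennreal \<epsilon>"
    using cover by blast
qed

section \<open>Lower bound for the dimension\<close>

text \<open>Bernoulli's inequality for the square root of \<open>x\<close>, squared.\<close>

lemma square_le_exponential:
  fixes x :: real
  assumes "x > 1"
  shows "\<exists>c. 0 < c \<and> c \<le> 1 \<and> (\<forall>n. c * real (n + 1) ^ 2 \<le> x ^ n)"
proof -
  define y where "y = sqrt x"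
  have y: "y > 1" "x = y ^ 2" using assms by (auto simp: y_def)
  define h where "h = min 1 (y - 1)"
  have h: "h > 0" "h \<le> 1" using y by (auto simp: h_def)
  have "h ^ 2 * real (n + 1) ^ 2 \<le> x ^ n" for n
  proof -
    have "real n * h \<le> real n * (y - 1)" by (intro mult_left_mono) (auto simp: h_def)
    then have "h * real (n + 1) \<le> 1 + real n * (y - 1)" using h(2) by (simp add: algebra_simps)
    also have "\<dots> \<le> (1 + (y - 1)) ^ n" using y by (intro Bernoulli_inequality) simp
    finally have "h * real (n + 1) \<le> y ^ n" by simp
    then have "(h * real (n + 1)) ^ 2 \<le> (y ^ n) ^ 2" using h by (intro power_mono) auto
    then show ?thesis by (simp only: power_mult_distrib y(2) power_mult[symmetric] mult.commute)
  qed
  moreover have "h ^ 2 \<le> 1" using h by (simp add: power_le_one)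
  ultimately show ?thesis using h by (intro exI[of _ "h ^ 2"]) simp
qed

text \<open>The strict bound by \<open>e\<close> leaves room even for sets of diameter 0, which lie
  in cylinders of every length. The cylinder is chosen about as large as \<open>e\<close> allows;
  rounding to a power of \<open>q\<close> costs the factor \<open>q\<close>.\<close>

lemma small_set_in_cylinder:
  fixes U :: "'a::{field,finite} fls set"
  defines "q \<equiv> real CARD('a)"
  assumes s: "0 < s" "s < 1" and U: "U \<noteq> {}" "\<And>x y. x \<in> U \<Longrightarrow> y \<in> U \<Longrightarrow> laurent_dist x y \<le> 1"
    and less: "diam laurent_dist U powr s < e" and e: "e \<le> 1"
  obtains w where "\<And>\<Theta>. \<Theta> \<in> U \<Longrightarrow> map (digits \<Theta>) [0..<length w] = w"
    "(1 / q ^ length w) powr s \<le> q * e"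
proof -
  have q: "q \<ge> 2" unfolding q_def using card_field_ge_2[where ?'a = 'a] by simp
  have e0: "e > 0" using less powr_ge_zero[of "diam laurent_dist U" s] by linarith
  define D where "D = e powr (1 / s)"
  have D: "D > 0" "D \<le> 1" "D powr s = e"
    using e e0 s powr_mono2[of "1 / s" e 1] by (auto simp: D_def powr_powr)
  obtain \<Theta>\<^sub>0 where \<Theta>\<^sub>0: "\<Theta>\<^sub>0 \<in> U" using U(1) by blast
  have d0: "diam laurent_dist U \<ge> 0"
    using diam_ge[of U laurent_dist 1 \<Theta>\<^sub>0 \<Theta>\<^sub>0] U(2) \<Theta>\<^sub>0 laurent_dist_nonneg[of \<Theta>\<^sub>0 \<Theta>\<^sub>0] by fastforce
  have dD: "diam laurent_dist U < D"
  proof (rule ccontr)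
    assume "\<not> ?thesis"
    then have "D powr s \<le> diam laurent_dist U powr s" using D s by (intro powr_mono2) auto
    then show False using less D(3) by simp
  qed
  have "\<exists>n. (1 / q) ^ (n + 1) < D"
  proof -
    obtain n where "(1 / q) ^ n < D" using real_arch_pow_inv[of D "1 / q"] D q by auto
    moreover have "(1 / q) ^ (n + 1) \<le> (1 / q) ^ n" using q by (intro power_decreasing) auto
    ultimately show ?thesis by (metis le_less_trans)
  qed
  \<comment> \<open>Minimality yields \<open>(1 / q) ^ (n + 1) < D \<le> (1 / q) ^ n\<close>; for
    \<open>n = 0\<close> the second inequality rests on \<open>e \<le> 1\<close>.\<close>
  define n where "n = (LEAST n. (1 / q) ^ (n + 1) < D)"
  have n: "(1 / q) ^ (n + 1) < D" unfolding n_def by (rule LeastI_ex) fact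
  have Dn: "D \<le> (1 / q) ^ n"
  proof (cases n)
    case (Suc m)
    then have "\<not> (1 / q) ^ (m + 1) < D"
      using not_less_Least[of m "\<lambda>n. (1 / q) ^ (n + 1) < D"] by (simp add: n_def)
    then show ?thesis using Suc by simp
  qed (use D in simp)
  define w where "w = map (digits \<Theta>\<^sub>0) [0..<n]"
  have [simp]: "length w = n" by (simp add: w_def)
  have "map (digits \<Theta>) [0..<n] = w" if "\<Theta> \<in> U" for \<Theta>
  proof -
    have "laurent_dist \<Theta> \<Theta>\<^sub>0 \<le> diam laurent_dist U" using U(2) that \<Theta>\<^sub>0 by (rule diam_ge)
    also have "\<dots> < 1 / q ^ n" using dD Dn by (simp add: power_divide)
    finally show ?thesis unfolding w_def q_def by (rule digits_eq_of_laurent_dist_less)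
  qed
  moreover have "(1 / q ^ n) powr s \<le> q * e"
  proof -
    have "(1 / q ^ n) powr s = (q * (1 / q) ^ (n + 1)) powr s" using q by (simp add: power_divide)
    also have "\<dots> = q powr s * ((1 / q) ^ (n + 1)) powr s" using q by (intro powr_mult)
    also have "\<dots> \<le> q powr 1 * D powr s"
      using q n s by (intro mult_mono powr_mono powr_mono2) auto
    finally show ?thesis using D(3) q by simp
  qed
  ultimately show ?thesis using that[of w] by simp
qed

text \<open>Choosing one index for each element of \<open>G\<close> ensures that no weight is
  counted twice.\<close>

lemma card_image_le_of_weights:
  fixes z c :: real
  assumes "z > 0" "finite G" "G \<subseteq> w ` I"
    and weight: "\<And>i. i \<in> I \<Longrightarrow> w i \<in> G \<Longrightarrow> z \<le> e i"
    and total: "\<And>J. finite J \<Longrightarrow> J \<subseteq> I \<Longrightarrow> sum e J \<le> c"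
  shows "real (card G) * z \<le> c"
proof -
  obtain J where J: "J \<subseteq> I" "inj_on w J" "G = w ` J"
    using assms(3) by (auto simp: subset_image_inj)
  have fin: "finite J" using assms(2) J by (metis finite_imageD)
  have "real (card G) * z = (\<Sum>i\<in>J. z)" using J by (simp add: card_image)
  also have "\<dots> \<le> sum e J" using J by (intro sum_mono weight) auto
  also have "\<dots> \<le> c" using fin J(1) by (rule total)
  finally show ?thesis .
qed

text \<open>A cheap cover is enlarged to cylinders. Few of them have length \<open>n\<close>, since
  each costs about \<open>q powr (- s * n)\<close>; the gap between this and
  \<open>q powr (- n)\<close> pays for the quadratic factor in
  \<open>counterexample_avoiding\<close>, which then supplies an uncovered counterexample.\<close>

lemma covers_of_counterexamples_not_small:
  fixes s :: real
  defines "E \<equiv> tLC_counterexamples (log_sq (real CARD('a))) :: 'a::{field,finite} fls set"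
  assumes s: "0 < s" "s < 1"
  obtains \<epsilon> where "\<epsilon> > 0"
    "\<And>U. U \<in> delta_covers laurent_dist 1 E \<Longrightarrow> ennreal \<epsilon> \<le> (\<Sum>i. diam_powr laurent_dist s (U i))"
proof -
  define q where "q = real CARD('a)"
  have q: "q \<ge> 2" unfolding q_def using card_field_ge_2[where ?'a = 'a] by simp
  define x where "x = q powr (1 - s)"
  have "q powr 0 < x" unfolding x_def using q s by (intro powr_less_mono) auto
  then have "x > 1" using q by simp
  then obtain \<eta> where \<eta>: "0 < \<eta>" "\<eta> \<le> 1" "\<And>n. \<eta> * real (n + 1) ^ 2 \<le> x ^ n"
    using square_le_exponential by blast
  \<comment> \<open>The weights \<open>e\<close> below total at most \<open>2 * \<epsilon>\<close>
    and the cylinders cost a further factor \<open>q\<close>, which gives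
    \<open>\<eta> / 2\<close>.\<close>
  define \<epsilon> where "\<epsilon> = \<eta> / (4 * q)"
  have \<epsilon>: "\<epsilon> > 0" "2 * q * \<epsilon> = \<eta> / 2" using \<eta> q by (simp_all add: \<epsilon>_def)
  have "\<epsilon> \<le> 1 / (4 * 2)" unfolding \<epsilon>_def using \<eta> q by (intro frac_le) auto
  then have \<epsilon>2: "2 * \<epsilon> \<le> 1" by simp
  have "ennreal \<epsilon> \<le> (\<Sum>i. diam_powr laurent_dist s (U i))" if U: "U \<in> delta_covers laurent_dist 1 E" for U
  proof (rule ccontr)
    assume "\<not> ?thesis"
    then have small: "(\<Sum>i. diam_powr laurent_dist s (U i)) < ennreal \<epsilon>" by simp
    have cover: "E \<subseteq> (\<Union>i. U i)" and U1: "\<And>i x y. x \<in> U i \<Longrightarrow> y \<in> U i \<Longrightarrow> laurent_dist x y \<le> 1"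
      using U by (auto simp: delta_covers_def)
    define I where "I = {i. U i \<noteq> {}}"
    \<comment> \<open>The summable slack makes the bound strict, as
      \<open>small_set_in_cylinder\<close> requires, and adds at most \<epsilon> in total.\<close>
    define e where "e = (\<lambda>i. diam laurent_dist (U i) powr s + \<epsilon> * (1 / 2) ^ Suc i)"
    have total: "sum e J \<le> 2 * \<epsilon>" if J: "finite J" "J \<subseteq> I" for J
    proof -
      have "diam_powr laurent_dist s (U i) = ennreal (diam laurent_dist (U i) powr s)" if "i \<in> J" for i
        using that J(2) s by (auto simp: diam_powr_def I_def)
      then have "ennreal (\<Sum>i\<in>J. diam laurent_dist (U i) powr s) = (\<Sum>i\<in>J. diam_powr laurent_dist s (U i))"
        by simp
      also have "\<dots> \<le> (\<Sum>i. diam_powr laurent_dist s (U i))" using J by (intro sum_le_suminf) auto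
      finally have "ennreal (\<Sum>i\<in>J. diam laurent_dist (U i) powr s) \<le> ennreal \<epsilon>" using small by simp
      then have 1: "(\<Sum>i\<in>J. diam laurent_dist (U i) powr s) \<le> \<epsilon>" using \<epsilon> by (simp add: ennreal_le_iff)
      have "(\<Sum>i\<in>J. (1 / 2) ^ Suc i) \<le> (\<Sum>i. (1 / 2 :: real) ^ Suc i)"
        using J power_half_series by (intro sum_le_suminf) (auto simp: sums_iff)
      also have "\<dots> = 1" using power_half_series by (simp add: sums_iff)
      finally have "\<epsilon> * (\<Sum>i\<in>J. (1 / 2) ^ Suc i) \<le> \<epsilon> * 1" using \<epsilon> by (intro mult_left_mono) auto
      then show ?thesis using 1 by (simp only: e_def sum.distrib sum_distrib_left[symmetric])
    qed
    have "\<exists>w. (\<forall>\<Theta>\<in>U i. map (digits \<Theta>) [0..<length w] = w) \<and> (1 / q ^ length w) powr s \<le> q * e i"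
      if "i \<in> I" for i
    proof -
      have "U i \<noteq> {}" using that by (simp add: I_def)
      moreover note U1[of _ i]
      moreover have "diam laurent_dist (U i) powr s < e i" using \<epsilon> by (simp add: e_def)
      moreover have "e i \<le> 1" using total[of "{i}"] that \<epsilon>2 by simp
      ultimately show ?thesis using small_set_in_cylinder[OF s, of "U i" "e i"] unfolding q_def by metis
    qed
    then obtain w where w: "\<And>i \<Theta>. i \<in> I \<Longrightarrow> \<Theta> \<in> U i \<Longrightarrow> map (digits \<Theta>) [0..<length (w i)] = w i"
      and we: "\<And>i. i \<in> I \<Longrightarrow> (1 / q ^ length (w i)) powr s \<le> q * e i" by metis
    define F where "F = w ` I"
    have count: "real (card {v \<in> F. length v = n}) * (1 / q ^ n) powr s \<le> \<eta> / 2" for n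
    proof (rule card_image_le_of_weights)
      show "(1 / q ^ n) powr s > 0" using q by simp
      show "finite {v \<in> F. length v = n}"
        by (rule finite_subset[OF _ finite_length_eq[of n]]) auto
      show "{v \<in> F. length v = n} \<subseteq> w ` I" by (auto simp: F_def)
      show "(1 / q ^ n) powr s \<le> q * e i" if "i \<in> I" "w i \<in> {v \<in> F. length v = n}" for i
        using we[OF that(1)] that(2) by simp
      show "(\<Sum>i\<in>J. q * e i) \<le> \<eta> / 2" if "finite J" "J \<subseteq> I" for J
      proof -
        have "(\<Sum>i\<in>J. q * e i) \<le> q * (2 * \<epsilon>)"
          unfolding sum_distrib_left[symmetric] using q by (intro mult_left_mono total that) auto
        then show ?thesis using \<epsilon>(2) by (simp only: mult_ac)
      qed
    qed
    \<comment> \<open>The empty word would carry weight 1, more than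
      \<open>\<eta> / 2\<close>.\<close>
    have "[] \<notin> F"
    proof
      assume "[] \<in> F"
      then have "{v \<in> F. length v = 0} = {[]}" by auto
      then show False using count[of 0] \<eta>(2) by simp
    qed
    moreover have "2 * (n + 1) * (n + 2) * card {v \<in> F. length v = n + 1} \<le> CARD('a) ^ (n + 1)" for n
    proof -
      define m where "m = n + 1"
      define f where "f = real (card {v \<in> F. length v = m})"
      define z where "z = (1 / q ^ m) powr s"
      have z: "z > 0" using q by (simp add: z_def)
      have "x ^ m = q ^ m * z"
        using q by (simp add: x_def z_def powr_diff power_divide powr_divide powr_powr
            powr_realpow[symmetric] mult.commute)
      then have "\<eta> * real (m + 1) ^ 2 \<le> q ^ m * z" using \<eta>(3)[of m] by simp
      moreover have "2 * real (m + 1) ^ 2 * (f * z) \<le> 2 * real (m + 1) ^ 2 * (\<eta> / 2)"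
        using count[of m] by (intro mult_left_mono) (simp_all add: f_def z_def)
      moreover have "2 * real (m + 1) ^ 2 * (\<eta> / 2) = \<eta> * real (m + 1) ^ 2" by simp
      ultimately have "(2 * real (m + 1) ^ 2 * f) * z \<le> q ^ m * z"
        unfolding mult.assoc[of _ f z] by linarith
      then have "2 * real (m + 1) ^ 2 * f \<le> q ^ m" using z by simp
      moreover have "2 * real m * real (m + 1) * f \<le> 2 * real (m + 1) ^ 2 * f"
        unfolding power2_eq_square by (intro mult_right_mono) (auto simp: f_def)
      ultimately have "2 * real m * real (m + 1) * f \<le> q ^ m" by linarith
      then have "real (2 * m * (m + 1) * card {v \<in> F. length v = m}) \<le> real (CARD('a) ^ m)"
        by (simp only: f_def q_def of_nat_mult of_nat_power of_nat_numeral)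
      then show ?thesis unfolding m_def of_nat_le_iff by (simp add: mult_ac)
    qed
    ultimately have "\<exists>\<Theta>\<in>E. \<forall>n. map (digits \<Theta>) [0..<n] \<notin> F"
      unfolding E_def by (rule counterexample_avoiding)
    then obtain \<Theta> where "\<Theta> \<in> E" and avoid: "\<And>n. map (digits \<Theta>) [0..<n] \<notin> F" by blast
    then obtain i where "\<Theta> \<in> U i" using cover by blast
    then have "i \<in> I" by (auto simp: I_def)
    then show False using w[OF _ \<open>\<Theta> \<in> U i\<close>] avoid[of "length (w i)"] by (simp add: F_def)
  qed
  then show ?thesis using that \<epsilon>(1) by blast
qed

theorem theorem1p1p4:
  shows "hausdorff_dim laurent_dist
           (tLC_counterexamples (log_sq (real CARD('a))) :: 'a::{field,finite} fls set) = 1"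
proof -
  let ?E = "tLC_counterexamples (log_sq (real CARD('a))) :: 'a fls set"
  have "?E \<subseteq> unit_interval" by (auto simp: tLC_counterexamples_def)
  have "hausdorff_dim laurent_dist ?E \<le> 1"
  proof (rule ennreal_le_epsilon)
    fix \<epsilon> :: real assume "\<epsilon> > 0"
    then have "hausdorff_dim laurent_dist ?E \<le> ennreal (1 + \<epsilon>)"
      unfolding hausdorff_dim_def
      using hausdorff_measure_unit_interval_eq_0[of "1 + \<epsilon>", OF _ \<open>?E \<subseteq> unit_interval\<close>]
      by (intro INF_lower) auto
    then show "hausdorff_dim laurent_dist ?E \<le> 1 + ennreal \<epsilon>"
      using \<open>\<epsilon> > 0\<close> by (simp add: ennreal_plus)
  qed
  moreover have "s \<ge> 1" if s: "s \<ge> 0" "hausdorff_measure laurent_dist s ?E = 0" for s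
  proof (rule ccontr)
    assume "\<not> s \<ge> 1"
    \<comment> \<open>The lower bound needs a positive exponent, so \<open>s = 0\<close> is replaced
      by 1/2.\<close>
    define s' where "s' = (if s = 0 then 1 / 2 else s)"
    have s': "0 < s'" "s' < 1" using s(1) \<open>\<not> s \<ge> 1\<close> by (auto simp: s'_def)
    from covers_of_counterexamples_not_small[OF s', where ?'a = 'a] obtain \<epsilon> where \<epsilon>: "\<epsilon> > 0"
      "\<And>U. U \<in> delta_covers laurent_dist 1 ?E \<Longrightarrow> ennreal \<epsilon> \<le> (\<Sum>i. diam_powr laurent_dist s' (U i))"
      by blast
    obtain U where U: "U \<in> delta_covers laurent_dist 1 ?E"
      "(\<Sum>i. diam_powr laurent_dist s (U i)) < ennreal \<epsilon>"
      using hausdorff_measure_eq_0D[OF s(2) _ \<epsilon>(1), of 1] by auto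
    \<comment> \<open>For \<open>s = 0\<close> a nonempty set contributes 1, which dominates the
      \<open>s'\<close>-th power of a diameter at most 1; this is why covers at scale 1 are
      used.\<close>
    have "diam_powr laurent_dist s' (U i) \<le> diam_powr laurent_dist s (U i)" for i
    proof (cases "s = 0 \<and> U i \<noteq> {}")
      case True
      have U1: "\<And>x y. x \<in> U i \<Longrightarrow> y \<in> U i \<Longrightarrow> laurent_dist x y \<le> 1"
        using U(1) by (auto simp: delta_covers_def)
      obtain \<Theta> where \<Theta>: "\<Theta> \<in> U i" using True by blast
      have "0 \<le> diam laurent_dist (U i)"
        using order_trans[OF laurent_dist_nonneg diam_ge[OF U1 \<Theta> \<Theta>]] .
      moreover have "diam laurent_dist (U i) \<le> 1" using True U1 by (intro diam_le) auto
      ultimately have "diam laurent_dist (U i) powr s' \<le> 1" using s' by (intro powr_le1) auto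
      then show ?thesis using True s' by (auto simp: diam_powr_def)
    qed (auto simp: s'_def diam_powr_def)
    then have "(\<Sum>i. diam_powr laurent_dist s' (U i)) \<le> (\<Sum>i. diam_powr laurent_dist s (U i))"
      by (intro suminf_le) auto
    then show False using \<epsilon>(2)[OF U(1)] U(2) by simp
  qed
  then have "1 \<le> hausdorff_dim laurent_dist ?E"
    unfolding hausdorff_dim_def by (intro INF_greatest) auto
  ultimately show ?thesis by (rule antisym)
qed

end
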